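(* Assume the nonresonance condition: the interior lattice Helmholtz problem $L^hu^h=0$ on $M^+$ with $u^h|_\gamma=0$ (for $u^h:N^+\to\mathbb{C}$) admits only the trivial solution. Let $P^h_\gamma$ be the LGF discrete Calderón projection. Then $$\operatorname{Im}P^h_\gamma=\operatorname{Im}P^h_{\gamma,\Omega_0}$$ for any Tsynkov-type discrete Calderón projection $P^h_{\gamma,\Omega_0}$ constructed from a well-posed auxiliary problem on a bounded lattice-aligned domain $\Omega_0\supset\overline{\Omega_{\rm in}}$. Both projections therefore characterize the same space of lattice-Helmholtz traces on $\gamma$.
   Context: Lattice and operator. Let $d\in\{2,3\}$, $h>0$, wavenumber $k>0$. Functions on the lattice $\Lambda_h=h\mathbb{Z}^d$ are indexed by $\mathbb{Z}^d$ (node $h\bm m\leftrightarrow\bm m$). The discrete Helmholtz operator is $$(L^hv)_{\bm m}=-\frac1{h^2}\sum_{\bm e\in\mathbb{Z}^d,\,|\bm e|_1=1}(v_{\bm m+\bm e}-v_{\bm m})-k^2v_{\bm m}.$$ Geometry. $\Omega_{\rm in}\subset\mathbb{R}^d$ is a bounded Lipschitz domain, $M^+=\{\bm m\in\mathbb{Z}^d: h\bm m\in\Omega_{\rm in}\}$, $M^-=\{\bm m\in\mathbb{Z}^d: h\bm m\notin\overline{\Omega_{\rm in}}\}$, and no lattice node lies on $\partial\Omega_{\rm in}$, so $\mathbb{Z}^d=M^+\sqcup M^-$. $N^\pm$ is the set of all nodes of the stencils of $L^h$ centred in $M^\pm$: $N^\pm=M^\pm\cup\{\bm m+\bm e:\bm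 m\in M^\pm,|\bm e|_1=1\}$. The boundary strip is $\gamma=N^+\cap N^-$. $\mathbf{1}_A$ is the indicator of $A$. A lattice-Helmholtz trace on $\gamma$ is the restriction $u^h|_\gamma$ of some $u^h:N^+\to\mathbb{C}$ with $L^hu^h=0$ on $M^+$. Lattice Green's function (LGF). $$G^h_{\bm m}=\frac1{(2\pi)^d}\int_{[-\pi,\pi]^d}\frac{e^{i\bm m\cdot\bm\theta}}{\sigma(\bm\theta)-k^2h^2+i0^+}\,d\bm\theta,\qquad \sigma(\bm\theta)=\sum_{j=1}^d2(1-\cos\theta_j),$$ where $i0^+$ means the limit $\varepsilon\to0^+$ with $i\varepsilon$ in place of $i0^+$; $(h,k)$ are such that the limit exists. Then $L^hG^h=h^{-2}\delta_{\bm 0}$. For finitely supported $f$, $(G^h\ast f)_{\bm m}=h^2\sum_{\bm n}G^h_{\bm m-\bm n}f_{\bm n}$, so $L^h(G^h\ast f)=f$. LGF projection. $V^h:\mathbb{Z}^d\to\mathbb{C}$ is an admissible extension of $\xi_\gamma:\gamma\to\mathbb{C}$ if $V^h|_\gamma=\xi_\gamma$, $L^hV^h$ has finite support, and either $V^h$ is finitely supported or $V^h=G^h\ast(L^hV^h)$ (the outgoing solution). Set $P^h\xi_\gamma=V^h-G^h\ast[(L^hV^h)\mathbf 1_{M^+}]$ and $P^h_\gamma\xi_\gamma=(P^h\xi_\gamma)|_\gamma$; the value $P^h_\gamma\xi_\gamma$ does not depend on the choice of $V^h$. Tsynkov-type projection. This is the discrete Calderón projection of the method of difference potentials, built on a finite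 auxiliary domain by inverting the discrete Helmholtz operator there with a chosen outer boundary condition; it is the same construction with convolution by $G^h$ replaced by the auxiliary inverse. In detail: $\Omega_0\supset\overline{\Omega_{\rm in}}$ is a bounded lattice-aligned domain, and a homogeneous linear boundary condition is chosen at its outer boundary. The auxiliary problem is: given a grid function $f$ on the interior nodes of $\Omega_0$, find a grid function $u$ on $\Omega_0$ satisfying the outer boundary condition with $L^hu=f$ at the interior nodes. It is well-posed if it is uniquely solvable for every $f$; write $u=(L^h_{\Omega_0})^{-1}f$. For $\xi_\gamma:\gamma\to\mathbb{C}$, take any extension $V$ of $\xi_\gamma$ to the grid of $\Omega_0$ satisfying the outer boundary condition, and set $$P^h_{\gamma,\Omega_0}\xi_\gamma=\Big(V-(L^h_{\Omega_0})^{-1}\big[(L^hV)\mathbf 1_{M^+}\big]\Big)\Big|_\gamma .$$ *)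

theory Defs
  imports "HOL-Analysis.Analysis"
begin

text \<open>
  The lattice \<open>h\<int>\<^sup>d\<close> is indexed by \<open>int ^ 'd\<close> with \<open>d = CARD('d)\<close>.
  Grid functions with a finite or restricted domain are either total functions of which only
  the values on that domain are used, or, where equality or uniqueness of functions matters,
  extensional functions on it (elements of \<open>A \<rightarrow>\<^sub>E UNIV\<close>).
\<close>

definition node :: "real \<Rightarrow> int ^ 'd \<Rightarrow> real ^ 'd" where
  "node h m = (\<chi> i. h * real_of_int (m $ i))"

definition unit_steps :: "(int ^ 'd) set" where
  "unit_steps = {e. (\<Sum>i\<in>UNIV. \<bar>e $ i\<bar>) = 1}"

definition helmholtz :: "real \<Rightarrow> real \<Rightarrow> (int ^ 'd \<Rightarrow> complex) \<Rightarrow> int ^ 'd \<Rightarrow> complex" where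
  "helmholtz h k v m =
     - of_real (1 / h\<^sup>2) * (\<Sum>e\<in>unit_steps. v (m + e) - v m) - of_real (k\<^sup>2) * v m"


subsection \<open>Geometry\<close>

text \<open>
  Near every boundary point the set is, in a rotated coordinate system with vertical
  direction \<open>\<nu>\<close>, the region strictly above the graph of a Lipschitz function \<open>\<phi>\<close> on the
  hyperplane orthogonal to \<open>\<nu>\<close>.
\<close>

definition lipschitz_domain :: "(real ^ 'd) set \<Rightarrow> bool" where
  "lipschitz_domain \<Omega> \<longleftrightarrow>
     open \<Omega> \<and> connected \<Omega> \<and> \<Omega> \<noteq> {} \<and>
     (\<forall>p\<in>frontier \<Omega>. \<exists>U \<nu> \<phi> C.
        open U \<and> p \<in> U \<and> norm \<nu> = 1 \<and>
        C-lipschitz_on {y. y \<bullet> \<nu> = 0} (\<phi> :: real ^ 'd \<Rightarrow> real) \<and>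
        \<Omega> \<inter> U = {x\<in>U. x \<bullet> \<nu> > \<phi> (x - (x \<bullet> \<nu>) *\<^sub>R \<nu>)})"

definition M_plus :: "real \<Rightarrow> (real ^ 'd) set \<Rightarrow> (int ^ 'd) set" where
  "M_plus h \<Omega> = {m. node h m \<in> \<Omega>}"

definition M_minus :: "real \<Rightarrow> (real ^ 'd) set \<Rightarrow> (int ^ 'd) set" where
  "M_minus h \<Omega> = {m. node h m \<notin> closure \<Omega>}"

definition stencil_nodes :: "(int ^ 'd) set \<Rightarrow> (int ^ 'd) set" where
  "stencil_nodes M = M \<union> {m + e | m e. m \<in> M \<and> e \<in> unit_steps}"

definition N_plus :: "real \<Rightarrow> (real ^ 'd) set \<Rightarrow> (int ^ 'd) set" where
  "N_plus h \<Omega> = stencil_nodes (M_plus h \<Omega>)"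

definition N_minus :: "real \<Rightarrow> (real ^ 'd) set \<Rightarrow> (int ^ 'd) set" where
  "N_minus h \<Omega> = stencil_nodes (M_minus h \<Omega>)"

definition strip :: "real \<Rightarrow> (real ^ 'd) set \<Rightarrow> (int ^ 'd) set" where
  "strip h \<Omega> = N_plus h \<Omega> \<inter> N_minus h \<Omega>"

definition restrict_zero :: "(int ^ 'd) set \<Rightarrow> (int ^ 'd \<Rightarrow> complex) \<Rightarrow> int ^ 'd \<Rightarrow> complex" where
  "restrict_zero A f m = (if m \<in> A then f m else 0)"

definition helmholtz_traces ::
    "real \<Rightarrow> real \<Rightarrow> (real ^ 'd) set \<Rightarrow> (int ^ 'd \<Rightarrow> complex) set" where
  "helmholtz_traces h k \<Omega> =
     {restrict u (strip h \<Omega>) | u. \<forall>m\<in>M_plus h \<Omega>. helmholtz h k u m = 0}"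

definition nonresonant :: "real \<Rightarrow> real \<Rightarrow> (real ^ 'd) set \<Rightarrow> bool" where
  "nonresonant h k \<Omega> \<longleftrightarrow>
     (\<forall>u. (\<forall>m\<in>M_plus h \<Omega>. helmholtz h k u m = 0) \<and> (\<forall>m\<in>strip h \<Omega>. u m = 0)
        \<longrightarrow> (\<forall>m\<in>N_plus h \<Omega>. u m = 0))"


subsection \<open>Lattice Green's function and its projection\<close>

definition symbol :: "real ^ 'd \<Rightarrow> real" where
  "symbol \<theta> = (\<Sum>j\<in>UNIV. 2 * (1 - cos (\<theta> $ j)))"

definition damped_lgf :: "real \<Rightarrow> real \<Rightarrow> int ^ 'd \<Rightarrow> real \<Rightarrow> complex" where
  "damped_lgf h k m \<epsilon> =
     of_real (1 / (2 * pi) ^ CARD('d)) *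
     integral (cbox (\<chi> i. - pi) (\<chi> i. pi))
       (\<lambda>\<theta> :: real ^ 'd. exp (\<i> * of_real (\<Sum>j\<in>UNIV. real_of_int (m $ j) * \<theta> $ j)) /
          (of_real (symbol \<theta> - k\<^sup>2 * h\<^sup>2) + \<i> * of_real \<epsilon>))"

definition lgf_exists :: "real \<Rightarrow> real \<Rightarrow> 'd::finite itself \<Rightarrow> bool" where
  "lgf_exists h k _ \<longleftrightarrow>
     (\<forall>m :: int ^ 'd. \<exists>l. (damped_lgf h k m \<longlongrightarrow> l) (at_right 0))"

definition lgf :: "real \<Rightarrow> real \<Rightarrow> int ^ 'd \<Rightarrow> complex" where
  "lgf h k m = Lim (at_right 0) (damped_lgf h k m)"

text \<open>Only meaningful for finitely supported \<open>f\<close>.\<close>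

definition lgf_conv :: "real \<Rightarrow> real \<Rightarrow> (int ^ 'd \<Rightarrow> complex) \<Rightarrow> int ^ 'd \<Rightarrow> complex" where
  "lgf_conv h k f m = of_real (h\<^sup>2) * (\<Sum>n | f n \<noteq> 0. lgf h k (m - n) * f n)"

definition admissible_extension ::
    "real \<Rightarrow> real \<Rightarrow> (real ^ 'd) set \<Rightarrow> (int ^ 'd \<Rightarrow> complex) \<Rightarrow> (int ^ 'd \<Rightarrow> complex) \<Rightarrow> bool" where
  "admissible_extension h k \<Omega> \<xi> V \<longleftrightarrow>
     (\<forall>m\<in>strip h \<Omega>. V m = \<xi> m) \<and>
     finite {m. helmholtz h k V m \<noteq> 0} \<and>
     (finite {m. V m \<noteq> 0} \<or> V = lgf_conv h k (helmholtz h k V))"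

text \<open>
  \<open>P\<^sup>h\<^sub>\<gamma>\<close>. The value does not depend on the choice of the admissible extension \<open>V\<close>, so the
  definite description denotes it.
\<close>

definition lgf_projection ::
    "real \<Rightarrow> real \<Rightarrow> (real ^ 'd) set \<Rightarrow> (int ^ 'd \<Rightarrow> complex) \<Rightarrow> int ^ 'd \<Rightarrow> complex" where
  "lgf_projection h k \<Omega> \<xi> =
     (THE \<eta>. \<exists>V. admissible_extension h k \<Omega> \<xi> V \<and>
        \<eta> = restrict
              (\<lambda>m. V m - lgf_conv h k (restrict_zero (M_plus h \<Omega>) (helmholtz h k V)) m)
              (strip h \<Omega>))"


subsection \<open>The auxiliary problem and the Tsynkov-type projection\<close>

text \<open>
  A bounded lattice-aligned domain is the (connected) interior of a finite union of closed
  lattice cells.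
\<close>

definition lattice_cell :: "real \<Rightarrow> int ^ 'd \<Rightarrow> (real ^ 'd) set" where
  "lattice_cell h m = cbox (node h m) (node h (m + 1))"

definition lattice_aligned_domain :: "real \<Rightarrow> (real ^ 'd) set \<Rightarrow> bool" where
  "lattice_aligned_domain h \<Omega>0 \<longleftrightarrow>
     connected \<Omega>0 \<and> \<Omega>0 \<noteq> {} \<and> (\<exists>C. finite C \<and> \<Omega>0 = interior (\<Union>m\<in>C. lattice_cell h m))"

definition grid_nodes :: "real \<Rightarrow> (real ^ 'd) set \<Rightarrow> (int ^ 'd) set" where
  "grid_nodes h \<Omega>0 = {m. node h m \<in> closure \<Omega>0}"

definition interior_nodes :: "real \<Rightarrow> (real ^ 'd) set \<Rightarrow> (int ^ 'd) set" where
  "interior_nodes h \<Omega>0 = {m. node h m \<in> \<Omega>0}"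

definition boundary_nodes :: "real \<Rightarrow> (real ^ 'd) set \<Rightarrow> (int ^ 'd) set" where
  "boundary_nodes h \<Omega>0 = {m. node h m \<in> frontier \<Omega>0}"

text \<open>
  A homogeneous linear boundary condition is a set \<open>B\<close> of homogeneous linear equations for the
  nodal values, each given by its coefficient function. That it is imposed at the outer
  boundary, and not inside \<open>\<Omega>\<close>, is expressed by admitting as unknowns only the grid nodes on
  the outer side \<open>N_minus\<close> of the strip. This leaves room for wide one-sided difference
  quotients and for nonlocal conditions; by the lemma below it always allows the full
  stencils of the outer boundary nodes, hence Dirichlet, Neumann and impedance conditions.
\<close>

definition outer_bc ::
    "real \<Rightarrow> (real ^ 'd) set \<Rightarrow> (real ^ 'd) set \<Rightarrow> (int ^ 'd \<Rightarrow> complex) set \<Rightarrow> bool" where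
  "outer_bc h \<Omega> \<Omega>0 B \<longleftrightarrow> (\<forall>c\<in>B. \<forall>m. c m \<noteq> 0 \<longrightarrow> m \<in> grid_nodes h \<Omega>0 \<inter> N_minus h \<Omega>)"

lemma boundary_stencil_subset_N_minus:
  assumes "closure \<Omega> \<subseteq> \<Omega>0" "open \<Omega>0"
  shows "stencil_nodes (boundary_nodes h \<Omega>0) \<subseteq> N_minus h \<Omega>"
  using assms
  by (auto simp: N_minus_def stencil_nodes_def boundary_nodes_def M_minus_def frontier_def
        interior_open subset_iff)

definition satisfies_bc ::
    "real \<Rightarrow> (real ^ 'd) set \<Rightarrow> (int ^ 'd \<Rightarrow> complex) set \<Rightarrow> (int ^ 'd \<Rightarrow> complex) \<Rightarrow> bool" where
  "satisfies_bc h \<Omega>0 B u \<longleftrightarrow> (\<forall>c\<in>B. (\<Sum>m\<in>grid_nodes h \<Omega>0. c m * u m) = 0)"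

definition aux_solution ::
    "real \<Rightarrow> real \<Rightarrow> (real ^ 'd) set \<Rightarrow> (int ^ 'd \<Rightarrow> complex) set \<Rightarrow>
      (int ^ 'd \<Rightarrow> complex) \<Rightarrow> (int ^ 'd \<Rightarrow> complex) \<Rightarrow> bool" where
  "aux_solution h k \<Omega>0 B f u \<longleftrightarrow>
     u \<in> grid_nodes h \<Omega>0 \<rightarrow>\<^sub>E UNIV \<and> satisfies_bc h \<Omega>0 B u \<and>
     (\<forall>m\<in>interior_nodes h \<Omega>0. helmholtz h k u m = f m)"

definition aux_well_posed ::
    "real \<Rightarrow> real \<Rightarrow> (real ^ 'd) set \<Rightarrow> (int ^ 'd \<Rightarrow> complex) set \<Rightarrow> bool" where
  "aux_well_posed h k \<Omega>0 B \<longleftrightarrow> (\<forall>f. \<exists>!u. aux_solution h k \<Omega>0 B f u)"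

definition aux_inverse ::
    "real \<Rightarrow> real \<Rightarrow> (real ^ 'd) set \<Rightarrow> (int ^ 'd \<Rightarrow> complex) set \<Rightarrow>
      (int ^ 'd \<Rightarrow> complex) \<Rightarrow> int ^ 'd \<Rightarrow> complex" where
  "aux_inverse h k \<Omega>0 B f = (THE u. aux_solution h k \<Omega>0 B f u)"

definition bc_extension ::
    "real \<Rightarrow> (real ^ 'd) set \<Rightarrow> (real ^ 'd) set \<Rightarrow> (int ^ 'd \<Rightarrow> complex) set \<Rightarrow>
      (int ^ 'd \<Rightarrow> complex) \<Rightarrow> (int ^ 'd \<Rightarrow> complex) \<Rightarrow> bool" where
  "bc_extension h \<Omega> \<Omega>0 B \<xi> V \<longleftrightarrow>
     V \<in> grid_nodes h \<Omega>0 \<rightarrow>\<^sub>E UNIV \<and> satisfies_bc h \<Omega>0 B V \<and> (\<forall>m\<in>strip h \<Omega>. V m = \<xi> m)"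

text \<open>
  The projection is defined on all \<open>\<xi>\<close> only if each of them extends to a grid function
  satisfying the boundary condition. This is automatic when the equations in \<open>B\<close> do not
  involve strip nodes, but it fails, for instance, for the Dirichlet condition when a strip
  node lies on the boundary of \<open>\<Omega>0\<close>.
\<close>

definition bc_extendable ::
    "real \<Rightarrow> (real ^ 'd) set \<Rightarrow> (real ^ 'd) set \<Rightarrow> (int ^ 'd \<Rightarrow> complex) set \<Rightarrow> bool" where
  "bc_extendable h \<Omega> \<Omega>0 B \<longleftrightarrow>
     (\<forall>\<xi> \<in> strip h \<Omega> \<rightarrow>\<^sub>E UNIV. \<exists>V. bc_extension h \<Omega> \<Omega>0 B \<xi> V)"

text \<open>As for \<open>lgf_projection\<close>, the value is the same for all extensions \<open>V\<close>.\<close>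

definition tsynkov_projection ::
    "real \<Rightarrow> real \<Rightarrow> (real ^ 'd) set \<Rightarrow> (real ^ 'd) set \<Rightarrow> (int ^ 'd \<Rightarrow> complex) set \<Rightarrow>
      (int ^ 'd \<Rightarrow> complex) \<Rightarrow> int ^ 'd \<Rightarrow> complex" where
  "tsynkov_projection h k \<Omega> \<Omega>0 B \<xi> =
     (THE \<eta>. \<exists>V. bc_extension h \<Omega> \<Omega>0 B \<xi> V \<and>
        \<eta> = restrict
              (\<lambda>m. V m - aux_inverse h k \<Omega>0 B (restrict_zero (M_plus h \<Omega>) (helmholtz h k V)) m)
              (strip h \<Omega>))"

end

theory Submission
  imports Defs
begin

text \<open>
  Convolution with \<open>G\<^sup>h\<close> inverts \<open>L\<^sup>h\<close> on finitely supported functions, because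
  \<open>L\<^sup>h G\<^sup>h = \<delta>\<^sub>0 / h\<^sup>2\<close>: for the damped symbol this is the Fourier orthogonality relation on the
  box, and the damping term vanishes in the limit. Hence for either inverse, convolution or
  auxiliary, subtracting it from an extension leaves a solution on \<open>M\<^sup>+\<close>, so the projection
  maps into the traces. Two extensions of the same data differ by a \<open>w\<close> vanishing on the strip;
  no stencil couples the part of \<open>w\<close> on \<open>M\<^sup>+\<close> to the rest, so this part is itself the inverse of
  \<open>L\<^sup>h w\<close> cut off to \<open>M\<^sup>+\<close> and the two values agree on the strip. Choosing for a trace
  an extension that solves the equation on \<open>M\<^sup>+\<close> shows that traces are fixed.
\<close>

section \<open>The lattice operator\<close>

lemma unit_steps_eq:
  "(unit_steps :: (int ^ 'd) set) = range (\<lambda>j. axis j 1) \<union> range (\<lambda>j. axis j (- 1))"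
proof (intro equalityI subsetI)
  fix e :: "int ^ 'd"
  assume "e \<in> unit_steps"
  then have s: "(\<Sum>i\<in>UNIV. \<bar>e $ i\<bar>) = 1"
    by (simp add: unit_steps_def)
  then obtain j where j: "e $ j \<noteq> 0"
    by (force intro: ccontr)
  have "(\<Sum>i\<in>UNIV. \<bar>e $ i\<bar>) = \<bar>e $ j\<bar> + (\<Sum>i\<in>UNIV - {j}. \<bar>e $ i\<bar>)"
    by (simp add: sum.remove)
  moreover have "0 \<le> (\<Sum>i\<in>UNIV - {j}. \<bar>e $ i\<bar>)"
    by (simp add: sum_nonneg)
  ultimately have "(\<Sum>i\<in>UNIV - {j}. \<bar>e $ i\<bar>) = 0" and ej: "\<bar>e $ j\<bar> = 1"
    using s j by linarith+
  then have "\<And>i. i \<noteq> j \<Longrightarrow> e $ i = 0"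
    by (subst (asm) sum_nonneg_eq_0_iff) auto
  then have e: "e = axis j (e $ j)"
    by (auto simp: vec_eq_iff axis_def)
  from ej have "e $ j = 1 \<or> e $ j = - 1"
    by linarith
  with e show "e \<in> range (\<lambda>j. axis j 1) \<union> range (\<lambda>j. axis j (- 1))"
    by auto
next
  fix e :: "int ^ 'd"
  assume "e \<in> range (\<lambda>j. axis j 1) \<union> range (\<lambda>j. axis j (- 1))"
  then show "e \<in> unit_steps"
    by (auto simp: unit_steps_def axis_def if_distrib cong: if_cong)
qed

lemma finite_unit_steps [simp]: "finite (unit_steps :: (int ^ 'd) set)"
  by (simp add: unit_steps_eq)

lemma uminus_mem_unit_steps_iff [simp]: "- e \<in> unit_steps \<longleftrightarrow> e \<in> unit_steps"
  by (simp add: unit_steps_def)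

text \<open>Pairing each step with its opposite lets the exponentials at the two neighbours combine
  into the cosines of \<open>symbol\<close>.\<close>

lemma sum_unit_steps:
  fixes f :: "int ^ 'd \<Rightarrow> 'a::comm_monoid_add"
  shows "(\<Sum>e\<in>unit_steps. f e) = (\<Sum>j\<in>UNIV. f (axis j 1) + f (axis j (- 1)))"
proof -
  have "(\<Sum>e\<in>unit_steps. f e)
      = (\<Sum>e\<in>range (\<lambda>j. axis j 1). f e) + (\<Sum>e\<in>range (\<lambda>j. axis j (- 1)). f e)"
    unfolding unit_steps_eq by (rule sum.union_disjoint) (auto simp: axis_eq_axis)
  also have "\<dots> = (\<Sum>j\<in>UNIV. f (axis j 1)) + (\<Sum>j\<in>UNIV. f (axis j (- 1)))"
    by (auto simp: sum.reindex inj_on_def axis_eq_axis)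
  finally show ?thesis
    by (simp add: sum.distrib)
qed

lemma stencil_nodes_altdef:
  "stencil_nodes M = M \<union> (\<Union>e\<in>unit_steps. (\<lambda>m. m + e) ` M)"
  by (auto simp: stencil_nodes_def)

lemma finite_stencil_nodes: "finite M \<Longrightarrow> finite (stencil_nodes M)"
  by (simp add: stencil_nodes_altdef)

lemma subset_stencil_nodes: "M \<subseteq> stencil_nodes M"
  by (auto simp: stencil_nodes_def)

lemma stencil_nodes_mono: "M \<subseteq> N \<Longrightarrow> stencil_nodes M \<subseteq> stencil_nodes N"
  by (auto simp: stencil_nodes_def)

lemma add_unit_step_mem_stencil_nodes:
  "m \<in> M \<Longrightarrow> e \<in> unit_steps \<Longrightarrow> m + e \<in> stencil_nodes M"
  by (auto simp: stencil_nodes_def)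

lemma helmholtz_cong:
  assumes "u m = v m" and "\<And>e. e \<in> unit_steps \<Longrightarrow> u (m + e) = v (m + e)"
  shows "helmholtz h k u m = helmholtz h k v m"
  using assms by (simp add: helmholtz_def)

lemma helmholtz_cong_stencil:
  assumes "\<And>n. n \<in> stencil_nodes M \<Longrightarrow> u n = v n" and "m \<in> M"
  shows "helmholtz h k u m = helmholtz h k v m"
  using assms
  by (intro helmholtz_cong) (auto simp: add_unit_step_mem_stencil_nodes subset_stencil_nodes[THEN subsetD])

lemma helmholtz_zero [simp]: "helmholtz h k (\<lambda>_. 0) m = 0"
  by (simp add: helmholtz_def)

lemma helmholtz_add:
  "helmholtz h k (\<lambda>m. u m + v m) m = helmholtz h k u m + helmholtz h k v m"
  by (simp add: helmholtz_def algebra_simps sum.distrib sum_subtractf)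

lemma helmholtz_diff:
  "helmholtz h k (\<lambda>m. u m - v m) m = helmholtz h k u m - helmholtz h k v m"
  by (simp add: helmholtz_def algebra_simps sum.distrib sum_subtractf)

lemma helmholtz_mult_left:
  "helmholtz h k (\<lambda>m. c * u m) m = c * helmholtz h k u m"
proof -
  have "(\<Sum>e\<in>unit_steps. c * u (m + e) - c * u m) = c * (\<Sum>e\<in>unit_steps. u (m + e) - u m)"
    by (simp add: sum_distrib_left right_diff_distrib)
  then show ?thesis
    by (simp add: helmholtz_def right_diff_distrib mult.left_commute)
qed

lemma helmholtz_mult_right:
  "helmholtz h k (\<lambda>m. u m * c) m = helmholtz h k u m * c"
  using helmholtz_mult_left[of h k c u m] by (simp add: mult.commute)

lemma helmholtz_sum:
  assumes "finite S"
  shows "helmholtz h k (\<lambda>m. \<Sum>n\<in>S. u n m) m = (\<Sum>n\<in>S. helmholtz h k (u n) m)"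
  using assms
proof (induction S)
  case empty
  then show ?case by (simp add: helmholtz_def)
qed (simp add: helmholtz_add)

lemma helmholtz_shift:
  "helmholtz h k (\<lambda>m. u (m - n)) m = helmholtz h k u (m - n)"
  by (simp add: helmholtz_def algebra_simps)

lemma support_helmholtz_subset:
  "{m. helmholtz h k v m \<noteq> 0} \<subseteq> stencil_nodes {m. v m \<noteq> 0}"
proof (rule subsetI, rule ccontr)
  fix m
  assume m: "m \<in> {m. helmholtz h k v m \<noteq> 0}" "m \<notin> stencil_nodes {m. v m \<noteq> 0}"
  have "v m = 0"
    using m(2) by (auto simp: stencil_nodes_def)
  \<comment> \<open>Unit steps are closed under negation, so a neighbour \<open>m + e\<close> in the
    support would put \<open>m\<close> into its stencil.\<close>
  moreover have "v (m + e) = 0" if "e \<in> unit_steps" for e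
    using that m(2) add_unit_step_mem_stencil_nodes[of "m + e" "{m. v m \<noteq> 0}" "- e"] by auto
  ultimately have "helmholtz h k v m = 0"
    by (simp add: helmholtz_def)
  with m(1) show False by simp
qed

lemma finite_support_helmholtz:
  "finite {m. v m \<noteq> 0} \<Longrightarrow> finite {m. helmholtz h k v m \<noteq> 0}"
  by (rule finite_subset[OF support_helmholtz_subset finite_stencil_nodes])

text \<open>
  Cutting off at the strip: a function vanishing there splits into an inner and an outer part
  that no stencil couples.
\<close>

lemma helmholtz_restrict_zero:
  assumes "\<And>m. m \<in> stencil_nodes M \<inter> stencil_nodes (- M) \<Longrightarrow> w m = 0"
  shows "helmholtz h k (restrict_zero M w) = restrict_zero M (helmholtz h k w)"
proof
  fix m
  show "helmholtz h k (restrict_zero M w) m = restrict_zero M (helmholtz h k w) m"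
  proof (cases "m \<in> M")
    case True
    \<comment> \<open>A stencil node of \<open>M\<close> lying outside \<open>M\<close> belongs to
      both stencil sets, where \<open>w\<close> already vanishes. The other case is
      symmetric.\<close>
    have "helmholtz h k (restrict_zero M w) m = helmholtz h k w m"
      using True assms subset_stencil_nodes[of "- M"]
      by (intro helmholtz_cong_stencil[where M = M]) (auto simp: restrict_zero_def)
    with True show ?thesis by (simp add: restrict_zero_def)
  next
    case False
    have "helmholtz h k (restrict_zero M w) m = helmholtz h k (\<lambda>_. 0) m"
      using False assms subset_stencil_nodes[of M]
      by (intro helmholtz_cong_stencil[where M = "- M"]) (auto simp: restrict_zero_def)
    with False show ?thesis by (simp add: restrict_zero_def helmholtz_def)
  qed
qed


section \<open>The lattice Green's function\<close>

text \<open>For \<open>n \<noteq> 0\<close> the antiderivative takes equal values at both ends of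
  the period. The indicator form makes the integral usable as one factor of a product
  integral.\<close>

lemma exp_int_integral:
  "(LINT x|lborel. indicator {- pi..pi} x *\<^sub>R exp (\<i> * of_real (real_of_int n * x)))
    = (if n = 0 then of_real (2 * pi) else 0)"
proof (cases "n = 0")
  case True
  then show ?thesis by (simp add: scaleR_conv_of_real[where 'a = complex])
next
  case False
  define a where "a = \<i> * complex_of_int n"
  have "((\<lambda>z. exp (a * z) / a) has_field_derivative exp (a * z)) (at z)" for z
    using False by (auto simp: a_def intro!: derivative_eq_intros)
  then have "((\<lambda>x. exp (a * of_real x) / a) has_vector_derivative exp (a * of_real x))
      (at x within {- pi..pi})" for x :: real
    by (rule has_vector_derivative_real_field)
  then have "(LINT x|lborel. indicator {- pi..pi} x *\<^sub>R exp (a * of_real x))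
      = exp (a * of_real pi) / a - exp (a * of_real (- pi)) / a"
    by (intro integral_FTC_Icc) (auto intro!: continuous_intros)
  then have "(LINT x|lborel. indicator {- pi..pi} x *\<^sub>R exp (\<i> * of_real (real_of_int n * x)))
      = exp (a * of_real pi) / a - exp (a * of_real (- pi)) / a"
    by (simp add: a_def mult.assoc)
  also have "\<dots> = (cis (of_int n * pi) - cis (- (of_int n * pi))) / (\<i> * of_int n)"
    by (simp add: a_def cis_conv_exp diff_divide_distrib mult.assoc)
  also have "cis (- (of_int n * pi)) = cis (of_int n * pi)"
    by (simp add: complex_eq_iff sin_zero_iff_int2)
  finally show ?thesis using False by simp
qed

text \<open>Exponential and box indicator both factor over the coordinates, so Fubini reduces the
  claim to \<open>exp_int_integral\<close>.\<close>

lemma integral_box_exp: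
  fixes m :: "int ^ 'd"
  shows "integral (cbox (\<chi> i. - pi) (\<chi> i. pi))
       (\<lambda>\<theta> :: real ^ 'd. exp (\<i> * of_real (\<Sum>j\<in>UNIV. real_of_int (m $ j) * \<theta> $ j)))
     = (if m = 0 then of_real ((2 * pi) ^ CARD('d)) else 0)"
proof -
  let ?Q = "cbox (\<chi> i. - pi) (\<chi> i. pi) :: (real ^ 'd) set"
  let ?E = "\<lambda>\<theta> :: real ^ 'd. exp (\<i> * of_real (\<Sum>j\<in>UNIV. real_of_int (m $ j) * \<theta> $ j))"
  \<comment> \<open>The factors are indexed by basis vectors because \<open>lborel\<close> is the
    image of the product measure over \<open>Basis\<close>; \<open>axis_index\<close> recovers the
    coordinate.\<close>
  let ?g = "\<lambda>(b :: real ^ 'd) x. indicator {- pi..pi} x *\<^sub>R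
              exp (\<i> * of_real (real_of_int (m $ axis_index b) * x))"
  let ?G = "\<lambda>\<theta> :: real ^ 'd. \<Prod>b\<in>Basis. ?g b (\<theta> \<bullet> b)"
  interpret product_sigma_finite "\<lambda>_ :: real ^ 'd. lborel :: real measure"
    by unfold_locales
  have Basis_eq: "(Basis :: (real ^ 'd) set) = range (\<lambda>i. axis i 1)"
    by (auto simp: Basis_vec_def)
  have inj: "inj (\<lambda>i. axis i 1 :: real ^ 'd)"
    by (auto simp: inj_on_def axis_eq_axis)
  have ind: "indicator ?Q \<theta> *\<^sub>R ?E \<theta> = ?G \<theta>" for \<theta> :: "real ^ 'd"
  proof -
    have "?G \<theta> = (\<Prod>j\<in>UNIV. indicator {- pi..pi} (\<theta> $ j) *\<^sub>R
                   exp (\<i> * of_real (real_of_int (m $ j) * \<theta> $ j)))"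
      unfolding Basis_eq by (simp add: prod.reindex[OF inj] inner_axis)
    also have "\<dots> = of_real (\<Prod>j\<in>UNIV. indicator {- pi..pi} (\<theta> $ j)) * ?E \<theta>"
      by (simp add: scaleR_conv_of_real prod.distrib exp_sum sum_distrib_left)
    also have "(\<Prod>j\<in>UNIV. indicator {- pi..pi} (\<theta> $ j)) = (indicator ?Q \<theta> :: real)"
      by (auto simp: indicator_def mem_box_cart)
    finally show ?thesis by (simp add: scaleR_conv_of_real)
  qed
  have "continuous_on ?Q ?E"
    by (intro continuous_intros continuous_on_component)
  then have "set_integrable lborel ?Q ?E"
    unfolding set_integrable_def by (intro borel_integrable_compact compact_cbox)
  then have "integral ?Q ?E = (LINT \<theta>:?Q|lborel. ?E \<theta>)"
    by (rule set_borel_integral_eq_integral(2)[symmetric])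
  also have "\<dots> = (LINT \<theta>|lborel. ?G \<theta>)"
    unfolding set_lebesgue_integral_def ind ..
  also have "\<dots> = integral\<^sup>L (Pi\<^sub>M Basis (\<lambda>_. lborel)) (\<lambda>f. \<Prod>b\<in>Basis. ?g b (f b))"
    by (subst lborel_eq, subst integral_distr) (simp_all add: inner_sum_left inner_Basis if_distrib sum.If_cases cong: if_cong)
  also have "\<dots> = (\<Prod>b\<in>Basis. LINT x|lborel. ?g b x)"
    by (intro product_integral_prod borel_integrable_compact continuous_intros) auto
  also have "\<dots> = (\<Prod>j\<in>UNIV. if m $ j = 0 then of_real (2 * pi) else 0)"
    unfolding Basis_eq exp_int_integral by (simp add: prod.reindex[OF inj])
  also have "\<dots> = (if m = 0 then of_real ((2 * pi) ^ CARD('d)) else 0)"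
    by (auto simp: vec_eq_iff)
  finally show ?thesis .
qed

section \<open>The damped Green's function and its limit\<close>

text \<open>Under the integral, the scaled operator multiplies the integrand by
  \<open>symbol \<theta> - k\<^sup>2 * h\<^sup>2\<close>. The damping term completes this factor to
  the denominator, and a pure exponential remains.\<close>

lemma helmholtz_damped_lgf:
  fixes m :: "int ^ 'd"
  assumes "h > 0" and "\<epsilon> > 0"
  shows "of_real (h\<^sup>2) * helmholtz h k (\<lambda>m. damped_lgf h k m \<epsilon>) m
      + \<i> * of_real \<epsilon> * damped_lgf h k m \<epsilon> = (if m = 0 then 1 else 0)"
proof -
  define Q where "Q = (cbox (\<chi> i. - pi) (\<chi> i. pi) :: (real ^ 'd) set)"
  define E where "E = (\<lambda>(m :: int ^ 'd) (\<theta> :: real ^ 'd).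
    exp (\<i> * of_real (\<Sum>j\<in>UNIV. real_of_int (m $ j) * \<theta> $ j)))"
  define D where "D = (\<lambda>\<theta> :: real ^ 'd.
    of_real (symbol \<theta> - k\<^sup>2 * h\<^sup>2) + \<i> * of_real \<epsilon> :: complex)"
  define I where "I = (\<lambda>m. integral Q (\<lambda>\<theta>. E m \<theta> / D \<theta>))"
  define c :: complex where "c = of_real (1 / (2 * pi) ^ CARD('d))"
  \<comment> \<open>The imaginary part of the denominator is \<open>\<epsilon>\<close>.\<close>
  have D_nz: "D \<theta> \<noteq> 0" for \<theta>
    using \<open>\<epsilon> > 0\<close> by (simp add: D_def complex_eq_iff)
  have "continuous_on Q (\<lambda>\<theta>. E m \<theta> / D \<theta>)" for m
    by (intro continuous_on_divide ballI D_nz) (auto simp: E_def D_def symbol_def intro!: continuous_intros)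
  then have I: "((\<lambda>\<theta>. E m \<theta> / D \<theta>) has_integral I m) Q" for m
    unfolding I_def Q_def by (intro integrable_integral integrable_continuous)
  have E_add: "E (m + n) \<theta> = E m \<theta> * E n \<theta>" for m n \<theta>
    by (simp add: E_def algebra_simps sum.distrib exp_add)
  have E_axis: "E (axis j a) \<theta> = cis (of_int a * \<theta> $ j)" for j a \<theta>
  proof -
    have "(\<Sum>i\<in>UNIV. real_of_int (axis j a $ i) * \<theta> $ i)
        = (\<Sum>i\<in>UNIV. if i = j then real_of_int a * \<theta> $ i else 0)"
      by (rule sum.cong) (auto simp: axis_def)
    then have "(\<Sum>i\<in>UNIV. real_of_int (axis j a $ i) * \<theta> $ i) = of_int a * \<theta> $ j"
      by simp
    then show ?thesis by (simp only: E_def cis_conv_exp)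
  qed
  have sum_E: "(\<Sum>e\<in>unit_steps. E e \<theta> - 1) = - of_real (symbol \<theta>)" for \<theta>
    by (simp add: sum_unit_steps E_axis symbol_def complex_eq_iff sum_negf[symmetric]
        sum.distrib[symmetric] algebra_simps)
  have "- (\<Sum>e\<in>unit_steps. E (m + e) \<theta> / D \<theta> - E m \<theta> / D \<theta>) - of_real (k\<^sup>2 * h\<^sup>2) * (E m \<theta> / D \<theta>)
      + \<i> * of_real \<epsilon> * (E m \<theta> / D \<theta>) = E m \<theta>" for \<theta>
  proof -
    have sum_eq: "(\<Sum>e\<in>unit_steps. E (m + e) \<theta> / D \<theta> - E m \<theta> / D \<theta>)
        = E m \<theta> / D \<theta> * (\<Sum>e\<in>unit_steps. E e \<theta> - 1)"
      unfolding sum_distrib_left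
      by (intro sum.cong) (simp_all add: E_add algebra_simps diff_divide_distrib)
    have D_eq: "D \<theta> = of_real (symbol \<theta>) - of_real (k\<^sup>2 * h\<^sup>2) + \<i> * of_real \<epsilon>"
      by (simp add: D_def)
    \<comment> \<open>With \<open>q\<close> the quotient \<open>E m \<theta> / D \<theta>\<close>,
      the other letters assemble to \<open>D \<theta>\<close>, which then cancels.\<close>
    have alg: "- (q * - s) - p * q + d * q = q * (s - p + d)" for q s p d :: complex
      by (simp add: algebra_simps)
    show ?thesis
      unfolding sum_eq sum_E alg D_eq[symmetric] by (simp add: D_nz)
  qed
  moreover have "((\<lambda>\<theta>. - (\<Sum>e\<in>unit_steps. E (m + e) \<theta> / D \<theta> - E m \<theta> / D \<theta>)
      - of_real (k\<^sup>2 * h\<^sup>2) * (E m \<theta> / D \<theta>) + \<i> * of_real \<epsilon> * (E m \<theta> / D \<theta>)) has_integral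
      (- (\<Sum>e\<in>unit_steps. I (m + e) - I m) - of_real (k\<^sup>2 * h\<^sup>2) * I m + \<i> * of_real \<epsilon> * I m)) Q"
    by (intro has_integral_add has_integral_diff has_integral_neg has_integral_sum
        has_integral_mult_right I finite_unit_steps)
  ultimately have "- (\<Sum>e\<in>unit_steps. I (m + e) - I m) - of_real (k\<^sup>2 * h\<^sup>2) * I m
      + \<i> * of_real \<epsilon> * I m = integral Q (E m)"
    by (simp add: integral_unique)
  also have "\<dots> = (if m = 0 then of_real ((2 * pi) ^ CARD('d)) else 0)"
    unfolding Q_def E_def by (rule integral_box_exp)
  finally have key: "c * (- (\<Sum>e\<in>unit_steps. I (m + e) - I m) - of_real (k\<^sup>2 * h\<^sup>2) * I m
      + \<i> * of_real \<epsilon> * I m) = (if m = 0 then 1 else 0)"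
    by (simp add: c_def)
  have G: "damped_lgf h k m \<epsilon> = c * I m" for m :: "int ^ 'd"
    by (simp add: damped_lgf_def c_def I_def E_def D_def Q_def)
  have helmholtz_I: "of_real (h\<^sup>2) * helmholtz h k I m
      = - (\<Sum>e\<in>unit_steps. I (m + e) - I m) - of_real (k\<^sup>2 * h\<^sup>2) * I m"
    using \<open>h > 0\<close> by (simp add: helmholtz_def field_simps)
  show ?thesis
    using key unfolding helmholtz_I[symmetric] G helmholtz_mult_left
    by (simp only: distrib_left mult.left_commute)
qed

text \<open>The operator is a finite linear combination, so it commutes with the limit; the damping
  term vanishes because the Green's function itself has a finite limit.\<close>

lemma helmholtz_lgf:
  fixes m :: "int ^ 'd"
  assumes "h > 0" and "lgf_exists h k TYPE('d)"
  shows "of_real (h\<^sup>2) * helmholtz h k (lgf h k) m = (if m = 0 then 1 else 0)"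
proof -
  have lim: "(damped_lgf h k n \<longlongrightarrow> lgf h k n) (at_right 0)" for n :: "int ^ 'd"
    using assms(2) unfolding lgf_exists_def lgf_def
    by (metis tendsto_Lim trivial_limit_at_right_real)
  have "((\<lambda>\<epsilon>. of_real (h\<^sup>2) * helmholtz h k (\<lambda>n. damped_lgf h k n \<epsilon>) m
      + \<i> * of_real \<epsilon> * damped_lgf h k m \<epsilon>) \<longlongrightarrow>
      of_real (h\<^sup>2) * helmholtz h k (lgf h k) m + \<i> * of_real 0 * lgf h k m) (at_right 0)"
    unfolding helmholtz_def by (intro tendsto_intros lim)
  moreover have "\<forall>\<^sub>F \<epsilon> in at_right 0. (if m = 0 then 1 else 0) =
      of_real (h\<^sup>2) * helmholtz h k (\<lambda>n. damped_lgf h k n \<epsilon>) m + \<i> * of_real \<epsilon> * damped_lgf h k m \<epsilon>"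
    using helmholtz_damped_lgf[OF \<open>h > 0\<close>, of _ k m] by (auto intro: eventually_at_rightI[of 0 1])
  then have "((\<lambda>\<epsilon>. of_real (h\<^sup>2) * helmholtz h k (\<lambda>n. damped_lgf h k n \<epsilon>) m
      + \<i> * of_real \<epsilon> * damped_lgf h k m \<epsilon>) \<longlongrightarrow> (if m = 0 then 1 else 0)) (at_right 0)"
    by (rule Lim_transform_eventually[rotated]) simp
  ultimately show ?thesis
    using tendsto_unique[OF trivial_limit_at_right_real] by fastforce
qed

section \<open>Convolution as a two-sided inverse\<close>

text \<open>Replaces the support by any larger finite set, so that convolutions of different
  functions can be summed over a common set.\<close>

lemma lgf_conv_eq:
  assumes "finite S" and "{n. f n \<noteq> 0} \<subseteq> S"
  shows "lgf_conv h k f m = of_real (h\<^sup>2) * (\<Sum>n\<in>S. lgf h k (m - n) * f n)"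
  using assms unfolding lgf_conv_def by (subst sum.mono_neutral_left[of S]) auto

lemma lgf_conv_diff:
  assumes "finite {n. f n \<noteq> 0}" and "finite {n. g n \<noteq> 0}"
  shows "lgf_conv h k (\<lambda>n. f n - g n) m = lgf_conv h k f m - lgf_conv h k g m"
proof -
  let ?S = "{n. f n \<noteq> 0} \<union> {n. g n \<noteq> 0}"
  have "finite ?S" using assms by simp
  then show ?thesis
    by (subst (1 2 3) lgf_conv_eq[of ?S])
      (auto simp: sum_subtractf algebra_simps)
qed

lemma helmholtz_lgf_conv:
  fixes f :: "int ^ 'd \<Rightarrow> complex"
  assumes "h > 0" and "lgf_exists h k TYPE('d)" and "finite {n. f n \<noteq> 0}"
  shows "helmholtz h k (lgf_conv h k f) = f"
proof
  fix m
  have "helmholtz h k (lgf_conv h k f) m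
      = (\<Sum>n | f n \<noteq> 0. of_real (h\<^sup>2) * helmholtz h k (lgf h k) (m - n) * f n)"
    unfolding lgf_conv_def using assms(3)
    by (simp add: helmholtz_mult_left helmholtz_mult_right helmholtz_sum
        helmholtz_shift[of _ _ "lgf h k"] sum_distrib_left mult.assoc)
  also have "\<dots> = (\<Sum>n | f n \<noteq> 0. if n = m then f n else 0)"
    unfolding helmholtz_lgf[OF assms(1,2)] by (intro sum.cong) auto
  also have "\<dots> = f m"
    using assms(3) by simp
  finally show "helmholtz h k (lgf_conv h k f) m = f m" .
qed

text \<open>Summation by parts: the operator moves from \<open>v\<close> onto the Green's function.
  The finite support of \<open>v\<close> leaves no boundary terms.\<close>

lemma lgf_conv_helmholtz:
  fixes v :: "int ^ 'd \<Rightarrow> complex"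
  assumes "h > 0" and "lgf_exists h k TYPE('d)" and fin: "finite {n. v n \<noteq> 0}"
  shows "lgf_conv h k (helmholtz h k v) = v"
proof
  fix m
  define S where "S = {n. v n \<noteq> 0}"
  \<comment> \<open>This finite set contains the supports of both \<open>v\<close> and
    \<open>helmholtz h k v\<close>.\<close>
  define T where "T = stencil_nodes S"
  let ?G = "lgf h k"
  have "finite S" "finite T"
    using fin by (simp_all add: S_def T_def finite_stencil_nodes)
  have v0: "v n = 0" if "n \<notin> S" for n
    using that by (simp add: S_def)
  have "S \<subseteq> T"
    by (simp add: T_def subset_stencil_nodes)
  \<comment> \<open>Substitute \<open>p = n + e\<close>. Terms with \<open>n + e\<close> outside
    \<open>S\<close> vanish, and \<open>p - e\<close> stays in \<open>T\<close> since
    \<open>- e\<close> is also a unit step.\<close>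
  have shift: "(\<Sum>n\<in>T. ?G (m - n) * v (n + e)) = (\<Sum>p\<in>S. ?G (m - p + e) * v p)"
    if e: "e \<in> unit_steps" for e
  proof (rule sum.reindex_bij_witness_not_neutral[where i = "\<lambda>p. p - e" and j = "\<lambda>n. n + e"
        and S' = "{n\<in>T. n + e \<notin> S}" and T' = "{}"])
    show "p - e \<in> T - {n \<in> T. n + e \<notin> S}" if "p \<in> S - {}" for p
      using that e add_unit_step_mem_stencil_nodes[of p S "- e"] by (auto simp: T_def)
  qed (auto simp: \<open>finite T\<close> v0 algebra_simps)
  have supp: "{n. helmholtz h k v n \<noteq> 0} \<subseteq> T"
    unfolding T_def S_def by (rule support_helmholtz_subset)
  have diag: "(\<Sum>n\<in>T. ?G (m - n) * v n) = (\<Sum>p\<in>S. ?G (m - p) * v p)"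
    using \<open>finite T\<close> \<open>S \<subseteq> T\<close> by (intro sum.mono_neutral_right) (auto simp: v0)
  have "(\<Sum>n\<in>T. ?G (m - n) * helmholtz h k v n)
      = - of_real (1 / h\<^sup>2) * (\<Sum>e\<in>unit_steps. (\<Sum>n\<in>T. ?G (m - n) * v (n + e)) - (\<Sum>n\<in>T. ?G (m - n) * v n))
        - of_real (k\<^sup>2) * (\<Sum>n\<in>T. ?G (m - n) * v n)"
    unfolding helmholtz_def sum_subtractf[symmetric]
    by (subst sum.swap) (simp add: sum_distrib_left sum_distrib_right sum_subtractf[symmetric] algebra_simps diff_divide_distrib)
  also have "\<dots> = - of_real (1 / h\<^sup>2) * (\<Sum>e\<in>unit_steps. (\<Sum>p\<in>S. ?G (m - p + e) * v p) - (\<Sum>p\<in>S. ?G (m - p) * v p))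
        - of_real (k\<^sup>2) * (\<Sum>p\<in>S. ?G (m - p) * v p)"
    by (simp add: shift diag cong: sum.cong)
  also have "\<dots> = (\<Sum>p\<in>S. helmholtz h k ?G (m - p) * v p)"
    unfolding helmholtz_def sum_subtractf[symmetric]
    by (subst sum.swap) (simp add: sum_distrib_left sum_distrib_right sum_subtractf[symmetric] algebra_simps diff_divide_distrib)
  finally have "lgf_conv h k (helmholtz h k v) m
      = (\<Sum>p\<in>S. of_real (h\<^sup>2) * helmholtz h k ?G (m - p) * v p)"
    by (simp add: lgf_conv_eq[OF \<open>finite T\<close> supp] sum_distrib_left mult.assoc)
  also have "\<dots> = (\<Sum>p\<in>S. if p = m then v p else 0)"
    unfolding helmholtz_lgf[OF assms(1,2)] by (intro sum.cong) auto
  also have "\<dots> = v m"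
    using \<open>finite S\<close> v0 by simp
  finally show "lgf_conv h k (helmholtz h k v) m = v m" .
qed

section \<open>The strip and the grid of the auxiliary domain\<close>

lemma finite_int_vec_bounded:
  assumes "finite A"
  shows "finite {m :: int ^ 'd. \<forall>i. m $ i \<in> A}"
proof (rule finite_subset)
  show "{m :: int ^ 'd. \<forall>i. m $ i \<in> A} \<subseteq> vec_lambda ` (UNIV \<rightarrow>\<^sub>E A)"
    by (auto intro!: image_eqI[where x = "vec_nth _"])
qed (simp add: assms finite_PiE)

lemma finite_M_plus:
  fixes \<Omega> :: "(real ^ 'd) set"
  assumes "h > 0" and "bounded \<Omega>"
  shows "finite (M_plus h \<Omega>)"
proof -
  from \<open>bounded \<Omega>\<close> obtain R where R: "\<And>x. x \<in> \<Omega> \<Longrightarrow> norm x \<le> R"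
    by (auto simp: bounded_iff)
  have "m $ i \<in> {- \<lceil>R / h\<rceil>..\<lceil>R / h\<rceil>}" if "m \<in> M_plus h \<Omega>" for m i
  proof -
    have "\<bar>node h m $ i\<bar> \<le> R"
      using R[of "node h m"] that component_le_norm_cart[of "node h m" i] by (simp add: M_plus_def)
    then have "\<bar>real_of_int (m $ i)\<bar> \<le> R / h"
      using \<open>h > 0\<close> by (simp add: node_def abs_mult field_simps)
    then have "of_int \<bar>m $ i\<bar> \<le> R / h" by simp
    then have "\<bar>m $ i\<bar> \<le> \<lceil>R / h\<rceil>"
      by linarith
    then show ?thesis by auto
  qed
  then show ?thesis
    by (intro finite_subset[OF _ finite_int_vec_bounded[of "{- \<lceil>R / h\<rceil>..\<lceil>R / h\<rceil>}"]]) auto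
qed

text \<open>An open set is its closure without the frontier, so a node off the frontier is either
  inside or outside the closure.\<close>

lemma M_minus_eq_Compl:
  assumes "open \<Omega>" and "\<And>m. node h m \<notin> frontier \<Omega>"
  shows "M_minus h \<Omega> = - M_plus h \<Omega>"
  using assms closure_subset[of \<Omega>]
  by (auto simp: M_minus_def M_plus_def frontier_def interior_open)

lemma strip_eq:
  assumes "M_minus h \<Omega> = - M_plus h \<Omega>"
  shows "strip h \<Omega> = stencil_nodes (M_plus h \<Omega>) \<inter> stencil_nodes (- M_plus h \<Omega>)"
  using assms by (simp add: strip_def N_plus_def N_minus_def)

text \<open>
  An interior node and a point of the open domain slightly beyond it in direction \<open>e\<close> lie in a
  common cell, which then contains the whole edge.
\<close>

lemma stencil_nodes_interior_subset_grid_nodes: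
  fixes \<Omega>0 :: "(real ^ 'd) set"
  assumes "h > 0" and "lattice_aligned_domain h \<Omega>0"
  shows "stencil_nodes (interior_nodes h \<Omega>0) \<subseteq> grid_nodes h \<Omega>0"
proof -
  from assms(2) obtain C where \<Omega>0: "\<Omega>0 = interior (\<Union>m\<in>C. lattice_cell h m)"
    by (auto simp: lattice_aligned_domain_def)
  have "m + e \<in> grid_nodes h \<Omega>0" if m: "m \<in> interior_nodes h \<Omega>0" and e: "e \<in> unit_steps" for m e
  proof -
    have "((\<lambda>t. node h m + t *\<^sub>R node h e) \<longlongrightarrow> node h m + 0 *\<^sub>R node h e) (at_right 0)"
      by (intro tendsto_intros)
    moreover have "open \<Omega>0" "node h m + 0 *\<^sub>R node h e \<in> \<Omega>0"
      using m by (simp_all add: \<Omega>0 interior_nodes_def)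
    ultimately have "\<forall>\<^sub>F t in at_right 0. node h m + t *\<^sub>R node h e \<in> \<Omega>0"
      by (rule topological_tendstoD)
    moreover have "\<forall>\<^sub>F t :: real in at_right 0. 0 < t \<and> t < 1"
      by (rule eventually_at_rightI[of 0 1]) auto
    ultimately have "\<forall>\<^sub>F t in at_right 0. node h m + t *\<^sub>R node h e \<in> \<Omega>0 \<and> 0 < t \<and> t < 1"
      by eventually_elim simp
    then obtain t :: real where t: "node h m + t *\<^sub>R node h e \<in> \<Omega>0" "0 < t" "t < 1"
      using eventually_happens'[OF trivial_limit_at_right_real] by blast
    then obtain c where "c \<in> C" and c: "node h m + t *\<^sub>R node h e \<in> lattice_cell h c"
      using interior_subset[of "\<Union>m\<in>C. lattice_cell h m"] \<Omega>0 by blast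
    have "c $ i \<le> m $ i + e $ i \<and> m $ i + e $ i \<le> c $ i + 1" for i
    proof -
      have "h * of_int (c $ i) \<le> h * (of_int (m $ i) + t * of_int (e $ i))"
           "h * (of_int (m $ i) + t * of_int (e $ i)) \<le> h * (of_int (c $ i) + 1)"
        using c by (simp_all add: lattice_cell_def mem_box_cart node_def algebra_simps)
      then have *: "of_int (c $ i) \<le> of_int (m $ i) + t * of_int (e $ i)"
           "of_int (m $ i) + t * of_int (e $ i) \<le> of_int (c $ i) + 1"
        using \<open>h > 0\<close> by simp_all
      have "e $ i = 1 \<or> e $ i = 0 \<or> e $ i = - 1"
        using e by (auto simp: unit_steps_eq axis_def)
      \<comment> \<open>Replacing \<open>t\<close> by 1 moves each coordinate by less than 1. The
        resulting strict inequalities between integers give back the non-strict cell bounds.\<close>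
      then have "t * of_int (e $ i) < of_int (e $ i) + 1" "of_int (e $ i) < t * of_int (e $ i) + 1"
        using t(2,3) by auto
      with * have "real_of_int (c $ i) < of_int (m $ i + e $ i + 1)"
          "real_of_int (m $ i + e $ i) < of_int (c $ i + 2)"
        by simp_all
      then show ?thesis
        unfolding of_int_less_iff by simp
    qed
    then have "real_of_int (c $ i) \<le> of_int (m $ i + e $ i) \<and> real_of_int (m $ i + e $ i) \<le> of_int (c $ i + 1)" for i
      by (simp only: of_int_le_iff)
    then have "node h (m + e) \<in> lattice_cell h c"
      using \<open>h > 0\<close> by (simp add: lattice_cell_def mem_box_cart node_def mult_left_mono)
    \<comment> \<open>The neighbour may lie on the boundary of the cell, so only membership in the
      closure of \<open>\<Omega>0\<close> can be concluded.\<close>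
    also have "lattice_cell h c = closure (interior (lattice_cell h c))"
      unfolding lattice_cell_def interior_cbox
      using \<open>h > 0\<close> by (intro closure_box[symmetric]) (simp add: interval_ne_empty_cart node_def)
    also have "\<dots> \<subseteq> closure \<Omega>0"
      unfolding \<Omega>0 using \<open>c \<in> C\<close> by (intro closure_mono interior_mono) auto
    finally show ?thesis by (simp add: grid_nodes_def)
  qed
  moreover have "interior_nodes h \<Omega>0 \<subseteq> grid_nodes h \<Omega>0"
    using closure_subset[of \<Omega>0] by (auto simp: interior_nodes_def grid_nodes_def)
  ultimately show ?thesis
    by (auto simp: stencil_nodes_def)
qed


section \<open>The projections and the traces\<close>

text \<open>Evaluates the definite description at any chosen extension. Only the source cut off to
  \<open>M_plus\<close> is convolved, so outgoing and finitely supported extensions are treated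
  alike.\<close>

lemma lgf_projection_eq:
  fixes \<Omega> :: "(real ^ 'd) set"
  assumes h: "h > 0" and G: "lgf_exists h k TYPE('d)"
    and fin: "finite (M_plus h \<Omega>)" and compl: "M_minus h \<Omega> = - M_plus h \<Omega>"
    and V: "admissible_extension h k \<Omega> \<xi> V"
  shows "lgf_projection h k \<Omega> \<xi> = restrict
      (\<lambda>m. V m - lgf_conv h k (restrict_zero (M_plus h \<Omega>) (helmholtz h k V)) m) (strip h \<Omega>)"
  unfolding lgf_projection_def
proof (rule the_equality)
  let ?M = "M_plus h \<Omega>"
  fix \<eta>
  assume "\<exists>V'. admissible_extension h k \<Omega> \<xi> V' \<and> \<eta> = restrict
      (\<lambda>m. V' m - lgf_conv h k (restrict_zero ?M (helmholtz h k V')) m) (strip h \<Omega>)"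
  then obtain V' where V': "admissible_extension h k \<Omega> \<xi> V'" and \<eta>: "\<eta> = restrict
      (\<lambda>m. V' m - lgf_conv h k (restrict_zero ?M (helmholtz h k V')) m) (strip h \<Omega>)"
    by blast
  define w where "w = (\<lambda>m. V' m - V m)"
  have w0: "w m = 0" if "m \<in> strip h \<Omega>" for m
    using V V' that by (simp add: admissible_extension_def w_def)
  have fin_restrict: "finite {m. restrict_zero ?M f m \<noteq> 0}" for f
    using fin by (rule finite_subset[rotated]) (auto simp: restrict_zero_def)
  have "(\<lambda>n. restrict_zero ?M (helmholtz h k V') n - restrict_zero ?M (helmholtz h k V) n)
      = restrict_zero ?M (helmholtz h k w)"
    by (auto simp: restrict_zero_def w_def helmholtz_diff)
  also have "\<dots> = helmholtz h k (restrict_zero ?M w)"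
    using w0 by (intro helmholtz_restrict_zero[symmetric]) (simp add: strip_eq[OF compl])
  \<comment> \<open>Although \<open>w\<close> may have infinite support, its cut-off to the finite
    set \<open>M_plus\<close> does not, so \<open>lgf_conv_helmholtz\<close> applies.\<close>
  finally have "lgf_conv h k (restrict_zero ?M (helmholtz h k V')) m
      - lgf_conv h k (restrict_zero ?M (helmholtz h k V)) m = restrict_zero ?M w m" for m
    by (simp add: lgf_conv_diff[symmetric] fin_restrict lgf_conv_helmholtz[OF h G])
  moreover have "restrict_zero ?M w m = w m" if "m \<in> strip h \<Omega>" for m
    using w0[OF that] by (simp add: restrict_zero_def)
  ultimately show "\<eta> = restrict
      (\<lambda>m. V m - lgf_conv h k (restrict_zero ?M (helmholtz h k V)) m) (strip h \<Omega>)"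
    unfolding \<eta> w_def by (intro restrict_ext) (simp add: algebra_simps)
qed (rule exI[where x = V], simp add: V)

lemma lgf_projection_image:
  fixes \<Omega> :: "(real ^ 'd) set"
  assumes h: "h > 0" and G: "lgf_exists h k TYPE('d)"
    and fin: "finite (M_plus h \<Omega>)" and compl: "M_minus h \<Omega> = - M_plus h \<Omega>"
  shows "lgf_projection h k \<Omega> ` (strip h \<Omega> \<rightarrow>\<^sub>E UNIV) = helmholtz_traces h k \<Omega>"
proof (intro equalityI subsetI)
  let ?M = "M_plus h \<Omega>"
  have fin_N: "finite (N_plus h \<Omega>)"
    using fin by (simp add: N_plus_def finite_stencil_nodes)
  {
    fix \<eta>
    assume "\<eta> \<in> lgf_projection h k \<Omega> ` (strip h \<Omega> \<rightarrow>\<^sub>E UNIV)"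
    then obtain \<xi> where \<eta>: "\<eta> = lgf_projection h k \<Omega> \<xi>"
      by blast
    \<comment> \<open>Extension by zero is admissible because the strip is finite.\<close>
    define V where "V = restrict_zero (strip h \<Omega>) \<xi>"
    define f where "f = restrict_zero ?M (helmholtz h k V)"
    have "finite {m. V m \<noteq> 0}"
      using fin_N by (rule finite_subset[rotated]) (auto simp: V_def restrict_zero_def strip_def)
    then have "admissible_extension h k \<Omega> \<xi> V"
      by (simp add: admissible_extension_def finite_support_helmholtz) (simp add: V_def restrict_zero_def)
    then have \<eta>_eq: "\<eta> = restrict (\<lambda>m. V m - lgf_conv h k f m) (strip h \<Omega>)"
      unfolding \<eta> f_def by (rule lgf_projection_eq[OF assms])
    have "finite {m. f m \<noteq> 0}"
      using fin by (rule finite_subset[rotated]) (auto simp: f_def restrict_zero_def)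
    then have "helmholtz h k (\<lambda>m. V m - lgf_conv h k f m) m = 0" if "m \<in> ?M" for m
      using that by (simp add: helmholtz_diff helmholtz_lgf_conv[OF h G]) (simp add: f_def restrict_zero_def)
    with \<eta>_eq show "\<eta> \<in> helmholtz_traces h k \<Omega>"
      by (auto simp: helmholtz_traces_def)
  next
    fix \<eta>
    assume "\<eta> \<in> helmholtz_traces h k \<Omega>"
    then obtain u where \<eta>: "\<eta> = restrict u (strip h \<Omega>)" and u: "\<And>m. m \<in> ?M \<Longrightarrow> helmholtz h k u m = 0"
      by (auto simp: helmholtz_traces_def)
    \<comment> \<open>Cutting \<open>u\<close> off outside \<open>N_plus\<close> gives finite
      support and leaves every stencil centred in \<open>M_plus\<close> untouched.\<close>
    define V where "V = restrict_zero (N_plus h \<Omega>) u"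
    have V_eq: "V m = u m" if "m \<in> N_plus h \<Omega>" for m
      using that by (simp add: V_def restrict_zero_def)
    have "finite {m. V m \<noteq> 0}"
      using fin_N by (rule finite_subset[rotated]) (auto simp: V_def restrict_zero_def)
    then have "admissible_extension h k \<Omega> \<eta> V"
      by (simp add: admissible_extension_def finite_support_helmholtz) (simp add: \<eta> V_eq strip_def)
    then have "lgf_projection h k \<Omega> \<eta> = restrict
        (\<lambda>m. V m - lgf_conv h k (restrict_zero ?M (helmholtz h k V)) m) (strip h \<Omega>)"
      by (rule lgf_projection_eq[OF assms])
    moreover have "restrict_zero ?M (helmholtz h k V) = (\<lambda>_. 0)"
    proof -
      have "helmholtz h k V m = helmholtz h k u m" if "m \<in> ?M" for m
        using that by (intro helmholtz_cong_stencil[where M = ?M]) (simp_all add: V_eq N_plus_def)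
      with u show ?thesis by (auto simp: restrict_zero_def)
    qed
    ultimately have "lgf_projection h k \<Omega> \<eta> = \<eta>"
      by (auto simp: lgf_conv_def \<eta> V_eq strip_def intro!: restrict_ext)
    moreover have "\<eta> \<in> strip h \<Omega> \<rightarrow>\<^sub>E UNIV"
      by (simp add: \<eta>)
    ultimately show "\<eta> \<in> lgf_projection h k \<Omega> ` (strip h \<Omega> \<rightarrow>\<^sub>E UNIV)"
      by (metis imageI)
  }
qed

section \<open>The auxiliary inverse and the Tsynkov-type projection\<close>

text \<open>The boundary equations see only the outer side of the strip, so a grid function may be
  altered on the inner side without violating them.\<close>

lemma satisfies_bc_cong:
  assumes "outer_bc h \<Omega> \<Omega>0 B" and "\<And>m. m \<in> grid_nodes h \<Omega>0 \<Longrightarrow> m \<in> N_minus h \<Omega> \<Longrightarrow> u m = v m"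
  shows "satisfies_bc h \<Omega>0 B u \<longleftrightarrow> satisfies_bc h \<Omega>0 B v"
proof -
  have "(\<Sum>m\<in>grid_nodes h \<Omega>0. c m * u m) = (\<Sum>m\<in>grid_nodes h \<Omega>0. c m * v m)" if "c \<in> B" for c
    using that assms by (intro sum.cong) (auto simp: outer_bc_def)
  then show ?thesis by (simp add: satisfies_bc_def)
qed

lemma aux_solution_aux_inverse:
  assumes "aux_well_posed h k \<Omega>0 B"
  shows "aux_solution h k \<Omega>0 B f (aux_inverse h k \<Omega>0 B f)"
  using assms theI'[where P = "aux_solution h k \<Omega>0 B f"]
  unfolding aux_inverse_def aux_well_posed_def by simp

lemma aux_inverse_eqI:
  assumes "aux_well_posed h k \<Omega>0 B" and "aux_solution h k \<Omega>0 B f u"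
  shows "aux_inverse h k \<Omega>0 B f = u"
  using assms the1_equality[where P = "aux_solution h k \<Omega>0 B f"]
  unfolding aux_inverse_def aux_well_posed_def by simp

text \<open>Auxiliary solutions must be extensional, so sums of them are restricted to the grid
  again; stencils of interior nodes do not notice this.\<close>

lemma helmholtz_restrict_grid:
  assumes "stencil_nodes (interior_nodes h \<Omega>0) \<subseteq> grid_nodes h \<Omega>0" and "m \<in> interior_nodes h \<Omega>0"
  shows "helmholtz h k (restrict u (grid_nodes h \<Omega>0)) m = helmholtz h k u m"
  using assms by (intro helmholtz_cong_stencil[where M = "interior_nodes h \<Omega>0"]) auto

text \<open>The cut-off difference of two extensions vanishes on \<open>N_minus\<close>. Adding it
  to one auxiliary solution keeps the boundary condition, and well-posedness identifies the sum with
  the other solution.\<close>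

lemma tsynkov_projection_eq:
  fixes \<Omega> :: "(real ^ 'd) set"
  assumes compl: "M_minus h \<Omega> = - M_plus h \<Omega>"
    and stencils: "stencil_nodes (interior_nodes h \<Omega>0) \<subseteq> grid_nodes h \<Omega>0"
    and bc: "outer_bc h \<Omega> \<Omega>0 B" and wp: "aux_well_posed h k \<Omega>0 B"
    and V: "bc_extension h \<Omega> \<Omega>0 B \<xi> V"
  shows "tsynkov_projection h k \<Omega> \<Omega>0 B \<xi> = restrict
      (\<lambda>m. V m - aux_inverse h k \<Omega>0 B (restrict_zero (M_plus h \<Omega>) (helmholtz h k V)) m)
      (strip h \<Omega>)"
  unfolding tsynkov_projection_def
proof (rule the_equality)
  let ?M = "M_plus h \<Omega>" and ?grid = "grid_nodes h \<Omega>0"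
  let ?U = "\<lambda>V. aux_inverse h k \<Omega>0 B (restrict_zero ?M (helmholtz h k V))"
  fix \<eta>
  assume "\<exists>V'. bc_extension h \<Omega> \<Omega>0 B \<xi> V' \<and> \<eta> = restrict (\<lambda>m. V' m - ?U V' m) (strip h \<Omega>)"
  then obtain V' where V': "bc_extension h \<Omega> \<Omega>0 B \<xi> V'"
    and \<eta>: "\<eta> = restrict (\<lambda>m. V' m - ?U V' m) (strip h \<Omega>)"
    by blast
  define w where "w = (\<lambda>m. V' m - V m)"
  have w0: "w m = 0" if "m \<in> strip h \<Omega>" for m
    using V V' that by (simp add: bc_extension_def w_def)
  let ?w = "restrict_zero ?M w"
  \<comment> \<open>A node of \<open>N_minus\<close> in \<open>M_plus\<close> lies on the strip,
    where \<open>w\<close> vanishes; any other is removed by the cut-off.\<close>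
  have w_outer: "?w m = 0" if "m \<in> N_minus h \<Omega>" for m
    using that w0[of m] subset_stencil_nodes[of ?M]
    by (auto simp: restrict_zero_def strip_def N_plus_def)
  have U: "aux_solution h k \<Omega>0 B (restrict_zero ?M (helmholtz h k V)) (?U V)"
    by (rule aux_solution_aux_inverse[OF wp])
  have Lw: "helmholtz h k ?w = restrict_zero ?M (helmholtz h k w)"
    using w0 by (intro helmholtz_restrict_zero) (simp add: strip_eq[OF compl])
  have U'_eq: "?U V' = restrict (\<lambda>m. ?U V m + ?w m) ?grid"
  proof (rule aux_inverse_eqI[OF wp])
    have "satisfies_bc h \<Omega>0 B (restrict (\<lambda>m. ?U V m + ?w m) ?grid) \<longleftrightarrow> satisfies_bc h \<Omega>0 B (?U V)"
      by (rule satisfies_bc_cong[OF bc]) (simp add: w_outer)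
    moreover have "helmholtz h k (restrict (\<lambda>m. ?U V m + ?w m) ?grid) m
        = restrict_zero ?M (helmholtz h k V') m" if "m \<in> interior_nodes h \<Omega>0" for m
    proof -
      have "helmholtz h k (restrict (\<lambda>m. ?U V m + ?w m) ?grid) m
          = restrict_zero ?M (helmholtz h k V) m + restrict_zero ?M (helmholtz h k w) m"
        using U that by (simp add: helmholtz_restrict_grid[OF stencils] helmholtz_add Lw aux_solution_def)
      then show ?thesis by (simp add: restrict_zero_def w_def helmholtz_diff)
    qed
    ultimately show "aux_solution h k \<Omega>0 B (restrict_zero ?M (helmholtz h k V'))
        (restrict (\<lambda>m. ?U V m + ?w m) ?grid)"
      using U by (simp add: aux_solution_def)
  qed
  have U'_strip: "?U V' m = ?U V m" if "m \<in> strip h \<Omega>" for m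
  proof (cases "m \<in> ?grid")
    case True
    with that show ?thesis
      unfolding U'_eq by (simp add: w_outer strip_def)
  next
    case False
    \<comment> \<open>Off the grid both solutions take the same default value.\<close>
    then have "?U V m = undefined"
      using U unfolding aux_solution_def by (blast intro: PiE_arb)
    with False show ?thesis
      unfolding U'_eq by simp
  qed
  have V'_strip: "V' m = V m" if "m \<in> strip h \<Omega>" for m
    using w0[OF that] by (simp add: w_def)
  show "\<eta> = restrict (\<lambda>m. V m - ?U V m) (strip h \<Omega>)"
    unfolding \<eta> by (rule restrict_ext) (simp only: U'_strip V'_strip)
qed (rule exI[where x = V], simp add: V)

lemma tsynkov_projection_image:
  fixes \<Omega> :: "(real ^ 'd) set"
  assumes compl: "M_minus h \<Omega> = - M_plus h \<Omega>"
    and stencils: "stencil_nodes (interior_nodes h \<Omega>0) \<subseteq> grid_nodes h \<Omega>0"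
    and M_sub: "M_plus h \<Omega> \<subseteq> interior_nodes h \<Omega>0"
    and bc: "outer_bc h \<Omega> \<Omega>0 B" and wp: "aux_well_posed h k \<Omega>0 B"
    and ext: "bc_extendable h \<Omega> \<Omega>0 B"
  shows "tsynkov_projection h k \<Omega> \<Omega>0 B ` (strip h \<Omega> \<rightarrow>\<^sub>E UNIV) = helmholtz_traces h k \<Omega>"
proof (intro equalityI subsetI)
  let ?M = "M_plus h \<Omega>" and ?grid = "grid_nodes h \<Omega>0"
  let ?U = "\<lambda>V. aux_inverse h k \<Omega>0 B (restrict_zero ?M (helmholtz h k V))"
  {
    fix \<eta>
    assume "\<eta> \<in> tsynkov_projection h k \<Omega> \<Omega>0 B ` (strip h \<Omega> \<rightarrow>\<^sub>E UNIV)"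
    then obtain \<xi> V where \<eta>: "\<eta> = tsynkov_projection h k \<Omega> \<Omega>0 B \<xi>"
      and V: "bc_extension h \<Omega> \<Omega>0 B \<xi> V"
      using ext by (auto simp: bc_extendable_def)
    have "\<eta> = restrict (\<lambda>m. V m - ?U V m) (strip h \<Omega>)"
      unfolding \<eta> by (rule tsynkov_projection_eq[OF compl stencils bc wp V])
    moreover have "helmholtz h k (\<lambda>m. V m - ?U V m) m = 0" if "m \<in> ?M" for m
      using that M_sub aux_solution_aux_inverse[OF wp, of "restrict_zero ?M (helmholtz h k V)"]
      by (auto simp: aux_solution_def helmholtz_diff restrict_zero_def)
    ultimately show "\<eta> \<in> helmholtz_traces h k \<Omega>"
      by (auto simp: helmholtz_traces_def)
  next
    fix \<eta>
    assume "\<eta> \<in> helmholtz_traces h k \<Omega>"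
    then obtain u where \<eta>: "\<eta> = restrict u (strip h \<Omega>)" and u: "\<And>m. m \<in> ?M \<Longrightarrow> helmholtz h k u m = 0"
      by (auto simp: helmholtz_traces_def)
    have \<eta>_mem: "\<eta> \<in> strip h \<Omega> \<rightarrow>\<^sub>E UNIV"
      by (simp add: \<eta>)
    then obtain V0 where V0: "bc_extension h \<Omega> \<Omega>0 B \<eta> V0"
      using ext by (auto simp: bc_extendable_def)
    have V0_strip: "V0 m = u m" if "m \<in> strip h \<Omega>" for m
      using V0 that by (simp add: bc_extension_def \<eta>)
    \<comment> \<open>The solution \<open>u\<close> need not satisfy the outer condition, so it is
      glued to an extension \<open>V0\<close> that does. They agree on the strip, so
      \<open>V\<close> equals \<open>u\<close> on all of \<open>N_plus\<close> and \<open>V0\<close>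
      on all of \<open>N_minus\<close>.\<close>
    define V where "V = (\<lambda>m. if m \<in> ?M then u m else V0 m)"
    have V_inner: "V m = u m" if "m \<in> N_plus h \<Omega>" for m
      using that V0_strip[of m] compl subset_stencil_nodes[of "M_minus h \<Omega>"]
      by (auto simp: V_def strip_def N_minus_def)
    have V_outer: "V m = V0 m" if "m \<in> N_minus h \<Omega>" for m
      using that V0_strip[of m] subset_stencil_nodes[of ?M]
      by (auto simp: V_def strip_def N_plus_def)
    have M_grid: "?M \<subseteq> ?grid"
      using M_sub stencils subset_stencil_nodes by blast
    have strip_grid: "strip h \<Omega> \<subseteq> ?grid"
      using stencil_nodes_mono[OF M_sub] stencils unfolding strip_def N_plus_def by blast
    have "satisfies_bc h \<Omega>0 B V \<longleftrightarrow> satisfies_bc h \<Omega>0 B V0"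
      by (rule satisfies_bc_cong[OF bc]) (rule V_outer)
    moreover have "V \<in> ?grid \<rightarrow>\<^sub>E UNIV"
      using V0 M_grid by (auto simp: bc_extension_def PiE_def extensional_def V_def)
    moreover have V_strip: "V m = u m" if "m \<in> strip h \<Omega>" for m
      using that V_inner by (simp add: strip_def)
    ultimately have "bc_extension h \<Omega> \<Omega>0 B \<eta> V"
      using V0 by (simp add: bc_extension_def \<eta>)
    then have "tsynkov_projection h k \<Omega> \<Omega>0 B \<eta> = restrict (\<lambda>m. V m - ?U V m) (strip h \<Omega>)"
      by (rule tsynkov_projection_eq[OF compl stencils bc wp])
    moreover have "restrict_zero ?M (helmholtz h k V) = (\<lambda>_. 0)"
    proof -
      have "helmholtz h k V m = helmholtz h k u m" if "m \<in> ?M" for m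
        using that by (intro helmholtz_cong_stencil[where M = ?M]) (simp_all add: V_inner N_plus_def)
      with u show ?thesis by (auto simp: restrict_zero_def)
    qed
    \<comment> \<open>The boundary equations are homogeneous, so zero on the grid is the solution
      for zero source.\<close>
    moreover have "aux_inverse h k \<Omega>0 B (\<lambda>_. 0) = restrict (\<lambda>_. 0) ?grid"
      by (rule aux_inverse_eqI[OF wp])
        (simp add: aux_solution_def satisfies_bc_def helmholtz_restrict_grid[OF stencils])
    ultimately have "tsynkov_projection h k \<Omega> \<Omega>0 B \<eta> = \<eta>"
      \<comment> \<open>Since the strip lies in the grid, the subtracted value is 0 there and not
        \<open>undefined\<close>.\<close>
      using strip_grid unfolding \<eta> by (auto simp: V_strip intro!: restrict_ext)
    with \<eta>_mem show "\<eta> \<in> tsynkov_projection h k \<Omega> \<Omega>0 B ` (strip h \<Omega> \<rightarrow>\<^sub>E UNIV)"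
      by (metis imageI)
  }
qed

theorem theorem3p3:
  fixes h k :: real
    and \<Omega>in \<Omega>0 :: "(real ^ 'd) set"
    and B :: "(int ^ 'd \<Rightarrow> complex) set"
  assumes "CARD('d) = 2 \<or> CARD('d) = 3"
    and "h > 0" and "k > 0"
    and "bounded \<Omega>in" and "lipschitz_domain \<Omega>in"
    and "\<forall>m. node h m \<notin> frontier \<Omega>in"
    and "lgf_exists h k TYPE('d)"
    and "nonresonant h k \<Omega>in"
    and "lattice_aligned_domain h \<Omega>0" and "closure \<Omega>in \<subseteq> \<Omega>0"
    and "outer_bc h \<Omega>in \<Omega>0 B"
    and "aux_well_posed h k \<Omega>0 B"
    and "bc_extendable h \<Omega>in \<Omega>0 B"
  shows "lgf_projection h k \<Omega>in ` (strip h \<Omega>in \<rightarrow>\<^sub>E UNIV)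
           = tsynkov_projection h k \<Omega>in \<Omega>0 B ` (strip h \<Omega>in \<rightarrow>\<^sub>E UNIV)
       \<and> lgf_projection h k \<Omega>in ` (strip h \<Omega>in \<rightarrow>\<^sub>E UNIV) = helmholtz_traces h k \<Omega>in
       \<and> tsynkov_projection h k \<Omega>in \<Omega>0 B ` (strip h \<Omega>in \<rightarrow>\<^sub>E UNIV) = helmholtz_traces h k \<Omega>in"
proof -
  \<comment> \<open>\<open>lipschitz_domain\<close> supplies the openness that
    \<open>M_minus_eq_Compl\<close> asks for.\<close>
  have compl: "M_minus h \<Omega>in = - M_plus h \<Omega>in"
    using assms(5,6) by (intro M_minus_eq_Compl) (simp_all add: lipschitz_domain_def)
  have "M_plus h \<Omega>in \<subseteq> interior_nodes h \<Omega>0"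
    using assms(10) closure_subset[of \<Omega>in] by (auto simp: M_plus_def interior_nodes_def)
  then have "tsynkov_projection h k \<Omega>in \<Omega>0 B ` (strip h \<Omega>in \<rightarrow>\<^sub>E UNIV) = helmholtz_traces h k \<Omega>in"
    using assms by (intro tsynkov_projection_image compl stencil_nodes_interior_subset_grid_nodes)
  moreover have "lgf_projection h k \<Omega>in ` (strip h \<Omega>in \<rightarrow>\<^sub>E UNIV) = helmholtz_traces h k \<Omega>in"
    using assms by (intro lgf_projection_image finite_M_plus compl)
  ultimately show ?thesis by simp
qed

end
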